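(* Let $R$ be a ring with unity. The following statements are equivalent: (1) $R$ is reversible. (2) For all $a,b\in R$, $ab\in R^{\sharp}$ implies $ba\in R^{\sharp}$.
   Context: Rings are associative with unity. A ring $R$ is reversible if for all $a,b\in R$, $ab=0$ implies $ba=0$. An element $a\in R$ is group invertible if there exists $x\in R$ with $axa=a$, $xax=x$, $ax=xa$; such $x$ is unique and denoted $a^{\sharp}$. $R^{\sharp}$ denotes the set of all group invertible elements of $R$. *)

theory Defs
  imports "HOL-Algebra.Ring"
begin

text \<open>
  The locale \<^locale>\<open>ring\<close> of HOL-Algebra describes associative rings with unity, not necessarily
  commutative; unlike the type class \<^class>\<open>ring_1\<close> it includes the zero ring.
\<close>

definition reversible_ring :: "('a, 'm) ring_scheme \<Rightarrow> bool" where
  "reversible_ring R \<longleftrightarrow>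
     (\<forall>a \<in> carrier R. \<forall>b \<in> carrier R. a \<otimes>\<^bsub>R\<^esub> b = \<zero>\<^bsub>R\<^esub> \<longrightarrow> b \<otimes>\<^bsub>R\<^esub> a = \<zero>\<^bsub>R\<^esub>)"

definition is_group_inverse :: "('a, 'm) ring_scheme \<Rightarrow> 'a \<Rightarrow> 'a \<Rightarrow> bool" where
  "is_group_inverse R a x \<longleftrightarrow>
     x \<in> carrier R \<and>
     a \<otimes>\<^bsub>R\<^esub> x \<otimes>\<^bsub>R\<^esub> a = a \<and>
     x \<otimes>\<^bsub>R\<^esub> a \<otimes>\<^bsub>R\<^esub> x = x \<and>
     a \<otimes>\<^bsub>R\<^esub> x = x \<otimes>\<^bsub>R\<^esub> a"

definition group_invertibles :: "('a, 'm) ring_scheme \<Rightarrow> 'a set" where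
  "group_invertibles R = {a \<in> carrier R. \<exists>x. is_group_inverse R a x}"

end

theory Submission
  imports Defs
begin

text \<open>If \<open>x\<close> is the group inverse of \<open>ab\<close>, then \<open>a (b - bxab) = 0\<close>, so reversibility gives
  \<open>ba = (bxa)(ba)\<close>. This is all that is missing for Cline's formula \<open>b x\<^sup>2 a\<close> to be a group inverse
  of \<open>ba\<close>. Conversely, if \<open>ab = 0\<close>, then \<open>(ba)\<^sup>2 = 0\<close>, and a group invertible element with
  square zero vanishes.\<close>

context ring
begin

lemma zero_in_group_invertibles: "\<zero> \<in> group_invertibles R"
  unfolding group_invertibles_def is_group_inverse_def by (auto intro!: exI[of _ \<zero>])

text \<open>Since a group inverse \<open>x\<close> commutes with \<open>a\<close>, the equation
  \<open>a x a = a\<close> exhibits \<open>a\<close> as a multiple of its own square.\<close>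

lemma group_invertible_square_zero:
  assumes "a \<in> group_invertibles R" "a \<otimes> a = \<zero>"
  shows "a = \<zero>"
proof -
  obtain x where a: "a \<in> carrier R" and x: "x \<in> carrier R"
    and axa: "a \<otimes> x \<otimes> a = a" and comm: "a \<otimes> x = x \<otimes> a"
    using assms(1) unfolding group_invertibles_def is_group_inverse_def by blast
  have "a = x \<otimes> (a \<otimes> a)"
    using axa comm a x by (simp add: m_assoc)
  then show ?thesis
    using assms(2) x by simp
qed

text \<open>Both products of \<open>b a\<close> with the candidate collapse to \<open>b x a\<close>,
  which settles commutation. It remains that \<open>b x a\<close> acts as a left identity on
  \<open>b a\<close> and on the candidate; reversibility enters only for \<open>b a\<close>.\<close>

lemma reversible_group_inverse_swap:
  assumes rev: "reversible_ring R" and a: "a \<in> carrier R" and b: "b \<in> carrier R"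
    and inv: "is_group_inverse R (a \<otimes> b) x"
  shows "is_group_inverse R (b \<otimes> a) (b \<otimes> x \<otimes> x \<otimes> a)"
proof -
  have x: "x \<in> carrier R" and cxc: "a \<otimes> b \<otimes> x \<otimes> (a \<otimes> b) = a \<otimes> b"
    and xcx: "x \<otimes> (a \<otimes> b) \<otimes> x = x" and comm: "a \<otimes> b \<otimes> x = x \<otimes> (a \<otimes> b)"
    using inv unfolding is_group_inverse_def by auto
  \<comment> \<open>Moving \<open>x\<close> past \<open>a b\<close> in \<open>x (a b) x = x\<close>
    gives the two one-sided forms \<open>cxx\<close> and \<open>xxc\<close>, which later cancel an
    inner \<open>a b\<close>.\<close>
  have cxx: "a \<otimes> b \<otimes> x \<otimes> x = x"
    by (simp only: comm xcx)
  have "x \<otimes> x \<otimes> (a \<otimes> b) = x \<otimes> (a \<otimes> b \<otimes> x)"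
    unfolding comm using a b x by (simp add: m_assoc)
  also have "\<dots> = x \<otimes> (a \<otimes> b) \<otimes> x"
    using a b x by (simp add: m_assoc)
  finally have xxc: "x \<otimes> x \<otimes> (a \<otimes> b) = x"
    by (simp only: xcx)
  \<comment> \<open>The right factor is chosen so that multiplying by \<open>a\<close> on the left
    yields the defect of \<open>cxc\<close>, which is zero.\<close>
  have "a \<otimes> (b \<ominus> b \<otimes> x \<otimes> (a \<otimes> b)) = a \<otimes> b \<ominus> a \<otimes> b \<otimes> x \<otimes> (a \<otimes> b)"
    using a b x by (simp add: minus_eq r_distr r_minus m_assoc)
  also have "\<dots> = \<zero>"
    using cxc a b by (simp add: minus_eq r_neg)
  finally have "(b \<ominus> b \<otimes> x \<otimes> (a \<otimes> b)) \<otimes> a = \<zero>"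
    using rev a b x unfolding reversible_ring_def by (meson m_closed minus_closed)
  then have "b \<otimes> a \<ominus> b \<otimes> x \<otimes> a \<otimes> (b \<otimes> a) = \<zero>"
    using a b x by (simp add: minus_eq l_distr l_minus m_assoc)
  \<comment> \<open>A vanishing difference gives equality: by uniqueness of additive inverses,
    \<open>b a\<close> is the double negative of the other product.\<close>
  then have ba: "b \<otimes> x \<otimes> a \<otimes> (b \<otimes> a) = b \<otimes> a"
    using a b x minus_equality[of "b \<otimes> a" "\<ominus> (b \<otimes> x \<otimes> a \<otimes> (b \<otimes> a))"]
    by (simp add: minus_eq)
  have left: "b \<otimes> a \<otimes> (b \<otimes> x \<otimes> x \<otimes> a) = b \<otimes> x \<otimes> a"
  proof -
    have "b \<otimes> a \<otimes> (b \<otimes> x \<otimes> x \<otimes> a) = b \<otimes> (a \<otimes> b \<otimes> x \<otimes> x) \<otimes> a"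
      using a b x by (simp add: m_assoc)
    then show ?thesis by (simp only: cxx)
  qed
  have right: "b \<otimes> x \<otimes> x \<otimes> a \<otimes> (b \<otimes> a) = b \<otimes> x \<otimes> a"
  proof -
    have "b \<otimes> x \<otimes> x \<otimes> a \<otimes> (b \<otimes> a) = b \<otimes> (x \<otimes> x \<otimes> (a \<otimes> b)) \<otimes> a"
      using a b x by (simp add: m_assoc)
    then show ?thesis by (simp only: xxc)
  qed
  have "b \<otimes> x \<otimes> a \<otimes> (b \<otimes> x \<otimes> x \<otimes> a) = b \<otimes> x \<otimes> (a \<otimes> b \<otimes> x \<otimes> x) \<otimes> a"
    using a b x by (simp add: m_assoc)
  then have "b \<otimes> x \<otimes> a \<otimes> (b \<otimes> x \<otimes> x \<otimes> a) = b \<otimes> x \<otimes> x \<otimes> a"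
    by (simp only: cxx)
  then show ?thesis
    unfolding is_group_inverse_def left right using a b x ba by (simp only: m_closed simp_thms)
qed

end

theorem theorem3p4:
  fixes R :: "('a, 'm) ring_scheme" (structure)
  assumes "ring R"
  shows "reversible_ring R \<longleftrightarrow>
    (\<forall>a \<in> carrier R. \<forall>b \<in> carrier R.
       a \<otimes> b \<in> group_invertibles R \<longrightarrow> b \<otimes> a \<in> group_invertibles R)"
proof
  interpret ring R by fact
  assume rev: "reversible_ring R"
  show "\<forall>a \<in> carrier R. \<forall>b \<in> carrier R.
       a \<otimes> b \<in> group_invertibles R \<longrightarrow> b \<otimes> a \<in> group_invertibles R"
    using reversible_group_inverse_swap[OF rev] unfolding group_invertibles_def by blast
next
  interpret ring R by fact
  assume swap: "\<forall>a \<in> carrier R. \<forall>b \<in> carrier R.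
       a \<otimes> b \<in> group_invertibles R \<longrightarrow> b \<otimes> a \<in> group_invertibles R"
  show "reversible_ring R"
    unfolding reversible_ring_def
  proof (intro ballI impI)
    fix a b
    assume a: "a \<in> carrier R" and b: "b \<in> carrier R" and ab: "a \<otimes> b = \<zero>"
    \<comment> \<open>Zero is its own group inverse, so \<open>swap\<close> applies to the product
      \<open>a b = \<zero>\<close>.\<close>
    have "b \<otimes> a \<in> group_invertibles R"
      using swap a b ab zero_in_group_invertibles by simp
    moreover have "b \<otimes> a \<otimes> (b \<otimes> a) = b \<otimes> (a \<otimes> b) \<otimes> a"
      using a b by (simp add: m_assoc)
    then have "b \<otimes> a \<otimes> (b \<otimes> a) = \<zero>"
      using a b ab by simp
    ultimately show "b \<otimes> a = \<zero>"
      by (rule group_invertible_square_zero)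
  qed
qed

end
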